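(* Let $\lambda_1(H_1(t))\le\cdots\le\lambda_n(H_1(t))$ be the (real) eigenvalues of $H_1(t)$, $t\in[0,T]$, and let $p^{\Diamond}$ be any real number with $p^{\Diamond}\ge \lambda_{\max}^+(H_1)\,T$. Then for every $t\in[0,T]$ the solution $\boldsymbol{u}(t)$ of $\frac{\mathrm{d}}{\mathrm{d}t}\boldsymbol{u}=A(t)\boldsymbol{u}$, $\boldsymbol{u}(0)=\boldsymbol{u}_0$, can be recovered from $\boldsymbol{w}$ by $$\boldsymbol{u}(t)=e^{p}\,\boldsymbol{w}(t,p)\qquad\text{for any } p\ge p^{\Diamond},$$ or by integration, $$\boldsymbol{u}(t)=e^{p}\int_p^{\infty}\boldsymbol{w}(t,q)\,dq\qquad\text{for any } p\ge p^{\Diamond}.$$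
   Context: Fix $T>0$, $n\ge1$, $A:[0,T]\to\mathbb{C}^{n\times n}$ continuous and $\boldsymbol{u}_0\in\mathbb{C}^n$. Write $A=H_1+iH_2$ with the Hermitian matrices $H_1=(A+A^\dagger)/2$, $H_2=(A-A^\dagger)/(2i)$ ($\dagger$ is the conjugate transpose). With $\sigma(\cdot)$ the set of eigenvalues, define $\lambda_{\max}^+(H_1)=\max\{\sup_{0<t<T}\{|\lambda|:\lambda\in\sigma(H_1(t)),\ \lambda>0\},\,0\}$ (the supremum of an empty set contributes nothing). The function $\boldsymbol{w}(t,p)$, $t\in[0,T]$, $p\in\mathbb{R}$, with values in $\mathbb{C}^n$, is the (unique, weak) solution of the Schrödingerized system $$\frac{\mathrm{d}}{\mathrm{d}t}\boldsymbol{w}=-H_1\partial_p\boldsymbol{w}+iH_2\boldsymbol{w},\qquad \boldsymbol{w}(0,p)=e^{-|p|}\boldsymbol{u}_0,$$ given explicitly by $\boldsymbol{w}(t,p)=\int_{\mathbb{R}}\frac{\mathcal{U}_{t,0}(\xi)\boldsymbol{u}_0}{\pi(1+\xi^2)}e^{-i\xi p}\,d\xi$, where the unitary matrix $\mathcal{U}_{t,0}(\xi)$ solves $\frac{\mathrm{d}}{\mathrm{d}t}\mathcal{U}_{t,0}(\xi)=i(\xi H_1(t)+H_2(t))\,\mathcal{U}_{t,0}(\xi)$, $\mathcal{U}_{0,0}(\xi)=I$. *)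

theory Defs
  imports "HOL-Analysis.Analysis"
begin

definition conj_transpose :: "complex^'n^'n \<Rightarrow> complex^'n^'n" where
  "conj_transpose M = map_matrix cnj (transpose M)"

text \<open>Multiplication of a matrix by a complex scalar. The library's \<open>*s\<close> is of no use here: on
  \<open>complex^'n^'n\<close> it expects its scalar in \<open>complex^'n\<close>.\<close>

definition cscale :: "complex \<Rightarrow> complex^'n^'n \<Rightarrow> complex^'n^'n" where
  "cscale c M = map_matrix ((*) c) M"

definition herm_part1 :: "complex^'n^'n \<Rightarrow> complex^'n^'n" where
  "herm_part1 M = cscale (1 / 2) (M + conj_transpose M)"

definition herm_part2 :: "complex^'n^'n \<Rightarrow> complex^'n^'n" where
  "herm_part2 M = cscale (1 / (2 * \<i>)) (M - conj_transpose M)"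

definition eigenvalues :: "complex^'n^'n \<Rightarrow> complex set" where
  "eigenvalues M = {l. \<exists>v. v \<noteq> 0 \<and> M *v v = l *s v}"

definition pos_eigenvalue_moduli :: "real \<Rightarrow> (real \<Rightarrow> complex^'n^'n) \<Rightarrow> real set" where
  "pos_eigenvalue_moduli T H =
     {\<bar>l\<bar> | l t. 0 < t \<and> t < T \<and> complex_of_real l \<in> eigenvalues (H t) \<and> l > 0}"

text \<open>The case distinction is needed because \<open>Sup {}\<close> is an unspecified real.\<close>

definition lambda_max_plus :: "real \<Rightarrow> (real \<Rightarrow> complex^'n^'n) \<Rightarrow> real" where
  "lambda_max_plus T H =
     (if pos_eigenvalue_moduli T H = {} then 0 else max (Sup (pos_eigenvalue_moduli T H)) 0)"

text \<open>\<open>U t \<xi>\<close> stands for \<open>\<U>\<^bsub>t,0\<^esub>(\<xi>)\<close>. Unitarity is not required, since it follows from the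
  equation; so does uniqueness of \<open>U\<close> on \<open>{0..T}\<close>. At the endpoints of \<open>{0..T}\<close> the derivatives
  are one-sided.\<close>

definition is_propagator ::
    "real \<Rightarrow> (real \<Rightarrow> complex^'n^'n) \<Rightarrow> (real \<Rightarrow> real \<Rightarrow> complex^'n^'n) \<Rightarrow> bool" where
  "is_propagator T A U \<longleftrightarrow>
     (\<forall>\<xi>. U 0 \<xi> = mat 1 \<and>
       (\<forall>t\<in>{0..T}. ((\<lambda>s. U s \<xi>) has_vector_derivative
          cscale \<i> (\<xi> *\<^sub>R herm_part1 (A t) + herm_part2 (A t)) ** U t \<xi>) (at t within {0..T})))"

text \<open>The weak solution \<open>w(t,p)\<close> of \<open>\<partial>\<^sub>t w = - H\<^sub>1 \<partial>\<^sub>p w + i H\<^sub>2 w\<close>, \<open>w(0,p) = e\<^bsup>-\<bar>p\<bar>\<^esup> u\<^sub>0\<close>, given by its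
  Fourier representation in \<open>p\<close> (the factor \<open>1 / (\<pi> (1 + \<xi>\<^sup>2))\<close> is the transform of \<open>e\<^bsup>-\<bar>p\<bar>\<^esup>\<close>).\<close>

definition schrodingerized ::
    "(real \<Rightarrow> real \<Rightarrow> complex^'n^'n) \<Rightarrow> complex^'n \<Rightarrow> real \<Rightarrow> real \<Rightarrow> complex^'n" where
  "schrodingerized U u0 t p =
     (LBINT \<xi>. exp (- \<i> * \<xi> * p) *s ((1 / (pi * (1 + \<xi>\<^sup>2))) *\<^sub>R (U t \<xi> *v u0)))"

end

theory Submission
  imports Defs "HOL-Complex_Analysis.Cauchy_Integral_Formula" "HOL-Probability.Sinc_Integral"
begin

text \<open>The propagator extends from real \<open>\<xi>\<close> to complex \<open>z\<close>: the solution \<open>v z t\<close> of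
  \<open>v' = \<i> (z H\<^sub>1 + H\<^sub>2) v\<close>, \<open>v z 0 = u\<^sub>0\<close> is entire in \<open>z\<close>, and at \<open>z = -\<i>\<close> the equation becomes
  \<open>u' = A u\<close>. For \<open>Im z \<le> 0\<close> the derivative of \<open>\<parallel>v\<parallel>\<^sup>2\<close> is \<open>-2 Im z \<langle>v, H\<^sub>1 v\<rangle>\<close>, so \<open>\<parallel>v z t\<parallel>\<close> grows at
  most like \<open>exp (-Im z \<lambda> t)\<close> with \<open>\<lambda> = \<lambda>\<^sub>m\<^sub>a\<^sub>x\<^sup>+(H\<^sub>1)\<close>; this is compensated by \<open>\<bar>exp (-\<i> z p)\<bar> = exp (Im z p)\<close> once
  \<open>p \<ge> \<lambda> T\<close>. Hence \<open>exp (-\<i> z p) v z t\<close> is bounded on the lower half plane, and integrating it against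
  \<open>1 / (\<pi> (1 + \<xi>\<^sup>2))\<close> gives its value at \<open>-\<i>\<close>, namely \<open>exp (-p) u t\<close>.\<close>

section \<open>Complex matrices and hermitian forms\<close>

lemma bounded_bilinear_matrix_vector_mult:
  "bounded_bilinear ((*v) :: complex^'n^'m \<Rightarrow> complex^'n \<Rightarrow> complex^'m)"
proof -
  have "bilinear ((*v) :: complex^'n^'m \<Rightarrow> complex^'n \<Rightarrow> complex^'m)"
    unfolding bilinear_def
    by (auto intro!: linearI simp: matrix_vector_mult_def vec_eq_iff algebra_simps sum.distrib
        scaleR_sum_right)
  thus ?thesis by (simp add: bilinear_conv_bounded_bilinear)
qed

lemma cscale_mult_vector: "cscale c M *v x = c *s (M *v x)"
  by (simp add: cscale_def map_matrix_def matrix_vector_mult_def vec_eq_iff sum_distrib_left mult.assoc)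

lemma mult_vector_smult: "(M::complex^'n^'m) *v (c *s x) = c *s (M *v x)"
  by (simp add: matrix_vector_mult_def vec_eq_iff sum_distrib_left algebra_simps)

lemma norm_smult_complex: "norm (c *s (x::complex^'n)) = cmod c * norm x"
  by (simp add: norm_vec_def L2_set_def norm_mult power_mult_distrib sum_distrib_left[symmetric]
      real_sqrt_mult)

lemma bounded_linear_smult: "bounded_linear ((*s) c :: complex^'n \<Rightarrow> complex^'n)"
  by (rule bounded_linear_intro[where K = "cmod c"])
     (auto simp: vec_eq_iff algebra_simps norm_smult_complex)

lemma cscale_cscale: "cscale a (cscale b M) = cscale (a * b) M"
  by (simp add: vec_eq_iff cscale_def map_matrix_def)

lemma cscale_add: "cscale a (M + N) = cscale a M + cscale a N"
  by (simp add: vec_eq_iff cscale_def map_matrix_def algebra_simps)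

lemma cscale_of_real: "cscale (complex_of_real r) M = r *\<^sub>R M"
  by (simp add: vec_eq_iff cscale_def map_matrix_def scaleR_conv_of_real[where 'a = complex])

lemma cscale_1: "cscale 1 M = M"
  by (simp add: vec_eq_iff cscale_def map_matrix_def)

lemma bounded_linear_smult_left: "bounded_linear (\<lambda>c. c *s (x::complex^'n))"
  by (rule bounded_linear_intro[where K = "norm x"])
     (auto simp: vec_eq_iff algebra_simps norm_smult_complex)

lemma smult_of_real: "complex_of_real r *s x = r *\<^sub>R (x::complex^'n)"
  by (simp add: vec_eq_iff scaleR_conv_of_real[where 'a = complex])

lemma continuous_on_cscale: "continuous_on S M \<Longrightarrow> continuous_on S (\<lambda>t. cscale c (M t))"
  unfolding cscale_def map_matrix_def by (intro continuous_intros)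

lemma continuous_on_conj_transpose: "continuous_on S M \<Longrightarrow> continuous_on S (\<lambda>t. conj_transpose (M t))"
  unfolding conj_transpose_def map_matrix_def transpose_def by (simp, intro continuous_intros)

lemma continuous_on_herm_part:
  assumes "continuous_on S M"
  shows "continuous_on S (\<lambda>t. herm_part1 (M t))" "continuous_on S (\<lambda>t. herm_part2 (M t))"
  unfolding herm_part1_def herm_part2_def
  by (intro continuous_on_cscale continuous_intros continuous_on_conj_transpose assms)+

lemma herm_part_decomp: "M = herm_part1 M + cscale \<i> (herm_part2 M)"
  by (simp add: vec_eq_iff herm_part1_def herm_part2_def cscale_def map_matrix_def field_simps)

lemma conj_transpose_herm_part:
  "conj_transpose (herm_part1 M) = herm_part1 M" "conj_transpose (herm_part2 M) = herm_part2 M"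
  by (simp_all add: vec_eq_iff herm_part1_def herm_part2_def cscale_def map_matrix_def
      conj_transpose_def transpose_def field_simps)

section \<open>Hermitian forms, Rayleigh quotients and \<open>lambda_max_plus\<close>\<close>

lemma inner_complex_vec: "x \<bullet> (y::complex^'n) = Re (\<Sum>i\<in>UNIV. cnj (x $ i) * y $ i)"
  by (simp add: inner_vec_def inner_complex_def)

text \<open>The full complex form is kept here because the real inner product sees only its real
  part, while \<open>hermitian_inner_cscale\<close> needs its imaginary part to vanish on the
  diagonal.\<close>

lemma hermitian_form_swap:
  assumes "conj_transpose K = K"
  shows "(\<Sum>i\<in>UNIV. cnj (x $ i) * (K *v y) $ i) = cnj (\<Sum>i\<in>UNIV. cnj (y $ i) * (K *v x) $ i)"
proof -
  have K: "cnj (K $ i $ j) = K $ j $ i" for i j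
    using arg_cong[OF assms, of "\<lambda>M. M $ j $ i"]
    by (simp add: conj_transpose_def map_matrix_def transpose_def)
  have "(\<Sum>i\<in>UNIV. cnj (x $ i) * (K *v y) $ i)
      = (\<Sum>i\<in>UNIV. \<Sum>j\<in>UNIV. cnj (x $ i) * K $ i $ j * y $ j)"
    by (simp add: matrix_vector_mult_def sum_distrib_left mult.assoc)
  also have "\<dots> = (\<Sum>j\<in>UNIV. \<Sum>i\<in>UNIV. cnj (x $ i) * K $ i $ j * y $ j)"
    by (rule sum.swap)
  also have "\<dots> = cnj (\<Sum>i\<in>UNIV. cnj (y $ i) * (K *v x) $ i)"
    by (simp add: matrix_vector_mult_def sum_distrib_left K algebra_simps)
  finally show ?thesis .
qed

lemma hermitian_inner_swap:
  "conj_transpose K = K \<Longrightarrow> x \<bullet> (K *v y) = y \<bullet> (K *v x)"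
  using arg_cong[OF hermitian_form_swap[of K x y], of Re] by (simp add: inner_complex_vec)

text \<open>A hermitian form is real on the diagonal, so a complex factor acts only through its real
  part. In the energy estimate this removes \<i> \<open>herm_part2\<close> altogether and turns the
  factor \<open>z * \<i>\<close> of \<open>herm_part1\<close> into \<open>- Im z\<close>.\<close>

lemma hermitian_inner_cscale:
  assumes "conj_transpose K = K"
  shows "x \<bullet> (cscale c K *v x) = Re c * (x \<bullet> (K *v x))"
proof -
  define S where "S = (\<Sum>i\<in>UNIV. cnj (x $ i) * (K *v x) $ i)"
  have "Im S = 0"
    using hermitian_form_swap[OF assms, of x x] by (simp add: S_def[symmetric] complex_eq_iff)
  moreover have "(\<Sum>i\<in>UNIV. cnj (x $ i) * (cscale c K *v x) $ i) = c * S"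
    by (simp add: S_def cscale_mult_vector sum_distrib_left algebra_simps)
  ultimately show ?thesis
    by (simp only: inner_complex_vec S_def[symmetric]) simp
qed

text \<open>By compactness the Rayleigh quotient attains its maximum on the unit sphere, and a
  maximiser is an eigenvector whose eigenvalue is that maximum.\<close>

lemma hermitian_rayleigh_bound:
  fixes K :: "complex^'n^'n"
  assumes K: "conj_transpose K = K"
  obtains l where "complex_of_real l \<in> eigenvalues K" "\<And>x. x \<bullet> (K *v x) \<le> l * (x \<bullet> x)"
proof -
  interpret bounded_bilinear "(*v) :: complex^'n^'n \<Rightarrow> complex^'n \<Rightarrow> complex^'n"
    by (rule bounded_bilinear_matrix_vector_mult)
  let ?S = "sphere 0 1 :: (complex^'n) set"
  have "continuous_on ?S (\<lambda>x. x \<bullet> (K *v x))"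
    by (intro continuous_intros continuous_on)
  moreover have "?S \<noteq> {}"
    using vector_choose_size[of 1] by auto
  ultimately obtain v where v: "v \<in> ?S" and max: "\<And>x. x \<in> ?S \<Longrightarrow> x \<bullet> (K *v x) \<le> v \<bullet> (K *v v)"
    using continuous_attains_sup[OF compact_sphere, of 0 1 "\<lambda>x. x \<bullet> (K *v x)"] by blast
  define l where "l = v \<bullet> (K *v v)"
  have bound: "x \<bullet> (K *v x) \<le> l * (x \<bullet> x)" for x
  proof (cases "x = 0")
    case False
    have "(x /\<^sub>R norm x) \<bullet> (K *v (x /\<^sub>R norm x)) \<le> l"
      unfolding l_def using False by (intro max) simp
    thus ?thesis
      using False by (simp add: scaleR_right field_simps power2_norm_eq_inner[symmetric] power2_eq_square)
  qed simp
  txt \<open>First variation of the nonnegative form \<open>l (x \<bullet> x) - x \<bullet> K x\<close> at its zero \<open>v\<close>.\<close>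
  have "K *v v = l *\<^sub>R v"
  proof -
    define h where "h = K *v v - l *\<^sub>R v"
    define c where "c = l * (h \<bullet> h) - h \<bullet> (K *v h)"
    have vv: "v \<bullet> v = 1" using v by (simp add: dot_square_norm)
    have le: "2 * s * (h \<bullet> h) \<le> s\<^sup>2 * c" for s
    proof -
      have e1: "(v + s *\<^sub>R h) \<bullet> (K *v (v + s *\<^sub>R h)) 
        = l + 2 * s * (h \<bullet> (K *v v)) + s\<^sup>2 * (h \<bullet> (K *v h))"
        using hermitian_inner_swap[OF K, of v h]
        by (simp add: l_def add_right scaleR_right inner_add_left inner_add_right power2_eq_square algebra_simps)
      have e2: "(v + s *\<^sub>R h) \<bullet> (v + s *\<^sub>R h) = 1 + 2 * s * (h \<bullet> v) + s\<^sup>2 * (h \<bullet> h)"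
        by (simp add: inner_add_left inner_add_right power2_eq_square algebra_simps vv inner_commute)
      have e3: "h \<bullet> (K *v v) = h \<bullet> h + l * (h \<bullet> v)"
        by (simp add: h_def inner_diff_left inner_diff_right)
      show ?thesis
        using bound[of "v + s *\<^sub>R h"] unfolding e1 e2 e3 by (simp add: c_def algebra_simps)
    qed
    have "h \<bullet> h = 0"
    proof (rule ccontr)
      assume "h \<bullet> h \<noteq> 0"
      hence pos: "h \<bullet> h > 0" by (simp add: order_less_le)
      \<comment> \<open>With this s the product s * c is at most h \<bullet> h, so the second-order
        term cannot make up for the first-order term 2 * (h \<bullet> h).\<close>
      define s where "s = (h \<bullet> h) / (\<bar>c\<bar> + 1)"
      have s: "s > 0" using pos by (simp add: s_def add_nonneg_pos)
      have "s * (2 * (h \<bullet> h)) \<le> s * (s * c)"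
        using le[of s] by (simp add: power2_eq_square algebra_simps)
      hence "2 * (h \<bullet> h) \<le> s * c" using s by simp
      also have "\<dots> \<le> s * (\<bar>c\<bar> + 1)" using s by (intro mult_left_mono) auto
      also have "\<dots> = h \<bullet> h"
        by (simp add: s_def)
      finally show False using pos by simp
    qed
    thus ?thesis by (simp add: h_def)
  qed
  hence "complex_of_real l \<in> eigenvalues K"
    using v by (auto simp: eigenvalues_def smult_of_real intro!: exI[of _ v])
  thus ?thesis using bound that by blast
qed

text \<open>The top eigenvalue l of \<open>H t\<close> is either nonpositive, and then below
  \<open>lambda_max_plus\<close>, or a member of the set whose supremum is taken. In the second case
  the set must be shown bounded above: every eigenvalue is bounded by the operator norm, and
  \<open>H\<close> is bounded on the compact interval.\<close>

lemma rayleigh_le_lambda_max_plus: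
  fixes H :: "real \<Rightarrow> complex^'n^'n"
  assumes cont: "continuous_on {0..T} H" and herm: "\<And>t. conj_transpose (H t) = H t"
    and t: "0 < t" "t < T"
  shows "x \<bullet> (H t *v x) \<le> lambda_max_plus T H * (x \<bullet> x)"
proof -
  obtain l where l: "complex_of_real l \<in> eigenvalues (H t)"
    and bound: "\<And>x. x \<bullet> (H t *v x) \<le> l * (x \<bullet> x)"
    using hermitian_rayleigh_bound[OF herm] by blast
  have "l \<le> lambda_max_plus T H"
  proof (cases "l > 0")
    case True
    obtain B where B: "\<And>M (y::complex^'n). norm (M *v y) \<le> norm (M::complex^'n^'n) * norm y * B" and "B > 0"
      using bounded_bilinear.pos_bounded[OF bounded_bilinear_matrix_vector_mult] by metis
    have "compact (H ` {0..T})"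
      by (intro compact_continuous_image cont compact_Icc)
    then obtain C where C: "\<And>s. s \<in> {0..T} \<Longrightarrow> norm (H s) \<le> C"
      by (meson compact_imp_bounded bounded_iff imageI)
    have "r \<le> C * B" if r: "r \<in> pos_eigenvalue_moduli T H" for r
    proof -
      obtain s v where s: "0 < s" "s < T" "v \<noteq> 0" "H s *v v = complex_of_real r *s v" "r > 0"
        using r unfolding pos_eigenvalue_moduli_def eigenvalues_def mem_Collect_eq
        by (metis abs_of_pos)
      have "r * norm v = norm (H s *v v)"
        using s by (simp add: norm_smult_complex)
      also have "\<dots> \<le> norm (H s) * norm v * B" by (rule B)
      also have "\<dots> \<le> C * norm v * B"
        using s \<open>B > 0\<close> by (intro mult_right_mono C) auto
      finally show ?thesis using s by simp
    qed
    hence "bdd_above (pos_eigenvalue_moduli T H)" by (rule bdd_aboveI)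
    moreover have "l \<in> pos_eigenvalue_moduli T H"
      unfolding pos_eigenvalue_moduli_def mem_Collect_eq using True t l by (metis abs_of_pos)
    ultimately show ?thesis
      unfolding lambda_max_plus_def using cSup_upper[of l] by (auto simp: le_max_iff_disj)
  next
    case False
    thus ?thesis by (auto simp: lambda_max_plus_def)
  qed
  thus ?thesis
    by (meson bound inner_ge_zero mult_right_mono order_trans)
qed

lemma lambda_max_plus_nonneg: "lambda_max_plus T H \<ge> 0"
  by (simp add: lambda_max_plus_def)

text \<open>Energy estimate: exp (- 2 * c * s) times the squared norm of \<open>y s\<close> has
  nonpositive derivative. The form bound is assumed only in the open interval, which matches the
  range of t in \<open>pos_eigenvalue_moduli\<close>; continuity takes care of the
  endpoints.\<close>

lemma linear_ode_norm_bound: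
  fixes y :: "real \<Rightarrow> complex^'n"
  assumes ode: "\<And>t. t \<in> {0..T} \<Longrightarrow> (y has_vector_derivative M t *v y t) (at t within {0..T})"
    and c: "\<And>t x. 0 < t \<Longrightarrow> t < T \<Longrightarrow> x \<bullet> (M t *v x) \<le> c * (x \<bullet> x)"
    and t: "t \<in> {0..T}"
  shows "norm (y t) \<le> exp (c * t) * norm (y 0)"
proof -
  let ?\<phi> = "\<lambda>s. exp (- 2 * c * s) * (y s \<bullet> y s)"
  have "continuous_on {0..T} y"
    using ode by (meson continuous_on_eq_continuous_within has_vector_derivative_continuous)
  hence cont: "continuous_on {0..t} ?\<phi>"
    using t by (intro continuous_intros) (auto intro: continuous_on_subset)
  have "?\<phi> t \<le> ?\<phi> 0"
  proof (rule DERIV_nonpos_imp_decreasing_open[OF _ _ cont])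
    fix s assume s: "0 < s" "s < t"
    hence "at s within {0..T} = at s"
      using t by (intro at_within_interior) auto
    hence d: "(y has_vector_derivative M s *v y s) (at s)"
      using ode[of s] s t by auto
    have "((\<lambda>s. y s \<bullet> y s) has_vector_derivative 2 * (y s \<bullet> (M s *v y s))) (at s)"
      using bounded_bilinear.has_vector_derivative[OF bounded_bilinear_inner d d]
      by (simp add: inner_commute)
    hence "((\<lambda>s. y s \<bullet> y s) has_real_derivative 2 * (y s \<bullet> (M s *v y s))) (at s)"
      by (simp add: has_real_derivative_iff_has_vector_derivative)
    hence "(?\<phi> has_real_derivative 
      2 * exp (- 2 * c * s) * (y s \<bullet> (M s *v y s) - c * (y s \<bullet> y s))) (at s)"
      by (auto intro!: derivative_eq_intros simp: algebra_simps)
    moreover have "2 * exp (- 2 * c * s) * (y s \<bullet> (M s *v y s) - c * (y s \<bullet> y s)) \<le> 0"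
      using c[of s "y s"] s t by (intro mult_nonneg_nonpos) auto
    ultimately show "\<exists>d. (?\<phi> has_real_derivative d) (at s) \<and> d \<le> 0" by blast
  qed (use t in auto)
  hence "y t \<bullet> y t \<le> (exp (c * t))\<^sup>2 * (y 0 \<bullet> y 0)"
    by (simp add: exp_minus field_simps power2_eq_square exp_add[symmetric])
  hence "(norm (y t))\<^sup>2 \<le> (exp (c * t) * norm (y 0))\<^sup>2"
    by (simp add: power_mult_distrib dot_square_norm)
  thus ?thesis by (rule power2_le_imp_le) simp
qed

text \<open>The difference of two solutions solves the same equation with initial value 0, so the
  energy estimate forces it to vanish.\<close>

lemma linear_ode_unique:
  fixes y1 y2 :: "real \<Rightarrow> complex^'n"
  assumes "\<And>t. t \<in> {0..T} \<Longrightarrow> (y1 has_vector_derivative M t *v y1 t) (at t within {0..T})"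
    and "\<And>t. t \<in> {0..T} \<Longrightarrow> (y2 has_vector_derivative M t *v y2 t) (at t within {0..T})"
    and "\<And>t x. 0 < t \<Longrightarrow> t < T \<Longrightarrow> x \<bullet> (M t *v x) \<le> c * (x \<bullet> x)"
    and "y1 0 = y2 0" and "t \<in> {0..T}"
  shows "y1 t = y2 t"
proof -
  have "norm (y1 t - y2 t) \<le> exp (c * t) * norm (y1 0 - y2 0)"
    using assms
    by (intro linear_ode_norm_bound[where y = "\<lambda>t. y1 t - y2 t" and M = M and T = T])
       (auto simp: matrix_vector_mult_diff_distrib intro!: has_vector_derivative_diff)
  thus ?thesis using assms(4) by simp
qed

section \<open>Linear equations with a holomorphic parameter\<close>

text \<open>Coefficient of z ^ j in the k-th Picard increment: the sum of the iterated integrals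
  over all words of length k in \<open>P\<close> and \<open>Q\<close> with exactly j letters
  \<open>P\<close>. The recursion splits on the outermost letter; for j = 0 it can only be
  \<open>Q\<close>.\<close>

primrec dyson_coeff ::
    "(real \<Rightarrow> complex^'n^'n) \<Rightarrow> (real \<Rightarrow> complex^'n^'n) \<Rightarrow> complex^'n \<Rightarrow> nat \<Rightarrow> nat \<Rightarrow> real \<Rightarrow> complex^'n"
  where
  "dyson_coeff P Q u0 0 j t = (if j = 0 then u0 else 0)"
| "dyson_coeff P Q u0 (Suc k) j t = integral {0..t} (\<lambda>s.
     (if j = 0 then 0 else P s *v dyson_coeff P Q u0 k (j - 1) s) + Q s *v dyson_coeff P Q u0 k j s)"

text \<open>The \<open>k\<close>-th term of the Dyson series of \<open>v' = (z P + Q) v\<close>, arranged by powers of \<open>z\<close> so that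
  its holomorphy in \<open>z\<close> is evident.\<close>

definition dyson_term ::
    "(real \<Rightarrow> complex^'n^'n) \<Rightarrow> (real \<Rightarrow> complex^'n^'n) \<Rightarrow> complex^'n \<Rightarrow> complex \<Rightarrow> nat \<Rightarrow> real \<Rightarrow> complex^'n"
  where "dyson_term P Q u0 z k t = (\<Sum>j\<le>k. z ^ j *s dyson_coeff P Q u0 k j t)"

lemma dyson_coeff_eq_0: "j > k \<Longrightarrow> dyson_coeff P Q u0 k j t = 0"
proof (induction k arbitrary: j t)
  case (Suc k)
  have "dyson_coeff P Q u0 k (j - 1) s = 0" "dyson_coeff P Q u0 k j s = 0" for s
    using Suc.prems by (auto intro: Suc.IH)
  thus ?case
    using Suc.prems by (cases "j = 0") (simp_all del: One_nat_def)
qed simp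

context
  fixes T :: real and P Q :: "real \<Rightarrow> complex^'n^'n" and u0 :: "complex^'n"
  assumes contP: "continuous_on {0..T} P" and contQ: "continuous_on {0..T} Q"
begin

lemma continuous_on_dyson_integrand:
  assumes "\<And>j. continuous_on {0..T} (dyson_coeff P Q u0 k j)"
  shows "continuous_on {0..T} (\<lambda>s. (if j = 0 then 0 else P s *v dyson_coeff P Q u0 k (j - 1) s)
    + Q s *v dyson_coeff P Q u0 k j s)"
  by (cases "j = 0") (auto intro!: continuous_intros assms contP contQ
      bounded_bilinear.continuous_on[OF bounded_bilinear_matrix_vector_mult])

lemma continuous_on_dyson_coeff: "continuous_on {0..T} (dyson_coeff P Q u0 k j)"
proof (induction k arbitrary: j)
  case (Suc k)
  show ?case
    unfolding dyson_coeff.simps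
    by (intro indefinite_integral_continuous_1 integrable_continuous_real
        continuous_on_dyson_integrand Suc.IH)
qed simp

lemma has_vector_derivative_dyson_term:
  assumes t: "t \<in> {0..T}"
  shows "(dyson_term P Q u0 z (Suc k) has_vector_derivative
    (cscale z (P t) + Q t) *v dyson_term P Q u0 z k t) (at t within {0..T})"
proof -
  let ?c = "dyson_coeff P Q u0 k"
  let ?g = "\<lambda>j s. (if j = 0 then 0 else P s *v ?c (j - 1) s) + Q s *v ?c j s"
  have "(dyson_coeff P Q u0 (Suc k) j has_vector_derivative ?g j t) (at t within {0..T})" for j
    unfolding dyson_coeff.simps
    by (intro integral_has_vector_derivative continuous_on_dyson_integrand continuous_on_dyson_coeff t)
  hence "(dyson_term P Q u0 z (Suc k) has_vector_derivative (\<Sum>j\<le>Suc k. z ^ j *s ?g j t))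
    (at t within {0..T})"
    unfolding dyson_term_def
    by (intro has_vector_derivative_sum bounded_linear.has_vector_derivative[OF bounded_linear_smult])
  also have "(\<Sum>j\<le>Suc k. z ^ j *s ?g j t)
    = (\<Sum>j\<le>Suc k. z ^ j *s (if j = 0 then 0 else P t *v ?c (j - 1) t)) + (\<Sum>j\<le>Suc k. z ^ j *s (Q t *v ?c j t))"
    by (simp only: vector_add_ldistrib sum.distrib)
  \<comment> \<open>The summand for j = 0 vanishes; shifting the index in the rest releases one
    factor z.\<close>
  also have "(\<Sum>j\<le>Suc k. z ^ j *s (if j = 0 then 0 else P t *v ?c (j - 1) t))
    = (\<Sum>j\<le>k. z *s (z ^ j *s (P t *v ?c j t)))"
    by (subst sum.atMost_Suc_shift) (simp add: vector_smult_assoc)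
  also have "\<dots> = cscale z (P t) *v dyson_term P Q u0 z k t"
    unfolding dyson_term_def cscale_mult_vector
    by (simp add: bounded_bilinear.sum_right[OF bounded_bilinear_matrix_vector_mult] mult_vector_smult
        linear_sum[OF bounded_linear.linear[OF bounded_linear_smult]])
  \<comment> \<open>The additional summand j = \<open>Suc k\<close> is zero, because a word of
    length k has no more than k letters \<open>P\<close>.\<close>
  also have "(\<Sum>j\<le>Suc k. z ^ j *s (Q t *v ?c j t)) = Q t *v dyson_term P Q u0 z k t"
    unfolding dyson_term_def
    by (simp add: dyson_coeff_eq_0 bounded_bilinear.sum_right[OF bounded_bilinear_matrix_vector_mult]
        mult_vector_smult)
  finally show ?thesis by (simp add: matrix_vector_mult_add_rdistrib)
qed

lemma dyson_term_0: "dyson_term P Q u0 z k 0 = (if k = 0 then u0 else 0)"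
  by (cases k) (simp_all add: dyson_term_def)

text \<open>Each term is the integral of the operator applied to the preceding one, so induction
  integrates the bound k times and produces the factorial.\<close>

lemma norm_dyson_term_le:
  assumes L: "\<And>s x. s \<in> {0..T} \<Longrightarrow> norm ((cscale z (P s) + Q s) *v x) \<le> L * norm x"
    and "L \<ge> 0" and t: "t \<in> {0..T}"
  shows "norm (dyson_term P Q u0 z k t) \<le> (L * t) ^ k / fact k * norm u0"
  using t
proof (induction k arbitrary: t)
  case 0
  thus ?case by (simp add: dyson_term_def)
next
  case (Suc k)
  let ?B = "\<lambda>s. (cscale z (P s) + Q s) *v dyson_term P Q u0 z k s"
  let ?m = "\<lambda>s. L * ((L * s) ^ k / fact k * norm u0)"
  have sub: "{0..t} \<subseteq> {0..T}" using Suc.prems by auto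
  have I: "(?B has_integral dyson_term P Q u0 z (Suc k) t - dyson_term P Q u0 z (Suc k) 0) {0..t}"
    using Suc.prems sub
    by (intro fundamental_theorem_of_calculus)
       (auto intro!: has_vector_derivative_within_subset[OF has_vector_derivative_dyson_term])
  \<comment> \<open>For a = (L * s) ^ k this says that the bound of index \<open>Suc k\<close> has
    derivative \<open>?m\<close>, by (k + 1) / (k + 1)! = 1 / k!.\<close>
  have "real (Suc k) * (L * a) / fact (Suc k) * norm u0 = L * (a / fact k * norm u0)" for a
    by (simp add: field_simps del: of_nat_Suc)
  moreover have "((\<lambda>s. (L * s) ^ Suc k) has_real_derivative real (Suc k) * (L * (L * s) ^ k)) (at s within {0..t})" for s
    using DERIV_power[OF DERIV_cmult_Id[of L s "{0..t}"], of "Suc k"] by simp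
  ultimately have "((\<lambda>s. (L * s) ^ Suc k / fact (Suc k) * norm u0) has_real_derivative ?m s) (at s within {0..t})" for s
    using DERIV_cmult_right[OF DERIV_cdivide] by metis
  hence J: "(?m has_integral (L * t) ^ Suc k / fact (Suc k) * norm u0 - (L * 0) ^ Suc k / fact (Suc k) * norm u0) {0..t}"
    using Suc.prems
    by (intro fundamental_theorem_of_calculus)
       (auto simp: has_real_derivative_iff_has_vector_derivative[symmetric])
  have "norm (integral {0..t} ?B) \<le> integral {0..t} ?m"
  proof (rule integral_norm_bound_integral)
    show "norm (?B s) \<le> ?m s" if "s \<in> {0..t}" for s
      using L[of s "dyson_term P Q u0 z k s"] Suc.IH[of s] that sub \<open>L \<ge> 0\<close>
      by (meson mult_left_mono order_trans subsetD)
  qed (use I J in auto)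
  thus ?case
    using integral_unique[OF I] integral_unique[OF J] by (simp add: dyson_term_0)
qed

lemma dyson_operator_bound:
  obtains L where "L \<ge> 0"
    "\<And>z s x. cmod z \<le> r \<Longrightarrow> s \<in> {0..T} \<Longrightarrow> norm ((cscale z (P s) + Q s) *v x) \<le> L * norm x"
proof -
  obtain B where B: "\<And>M (y::complex^'n). norm (M *v y) \<le> norm (M::complex^'n^'n) * norm y * B" and "B > 0"
    using bounded_bilinear.pos_bounded[OF bounded_bilinear_matrix_vector_mult] by metis
  have "bounded (P ` {0..T})" "bounded (Q ` {0..T})"
    by (intro compact_imp_bounded compact_continuous_image contP contQ compact_Icc)+
  then obtain p q where p: "\<And>s. s \<in> {0..T} \<Longrightarrow> norm (P s) \<le> p" and q: "\<And>s. s \<in> {0..T} \<Longrightarrow> norm (Q s) \<le> q"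
    unfolding bounded_iff by (metis imageI)
  show ?thesis
  proof (rule that[of "\<bar>r\<bar> * (\<bar>p\<bar> * B) + \<bar>q\<bar> * B"])
    show "0 \<le> \<bar>r\<bar> * (\<bar>p\<bar> * B) + \<bar>q\<bar> * B" using \<open>B > 0\<close> by simp
    fix z :: complex and s :: real and x :: "complex^'n"
    assume z: "cmod z \<le> r" and s: "s \<in> {0..T}"
    have "norm (P s *v x) \<le> \<bar>p\<bar> * norm x * B"
      using B[of "P s" x] p[OF s] \<open>B > 0\<close> by (smt (verit) mult_right_mono norm_ge_zero)
    moreover have "norm (Q s *v x) \<le> \<bar>q\<bar> * norm x * B"
      using B[of "Q s" x] q[OF s] \<open>B > 0\<close> by (smt (verit) mult_right_mono norm_ge_zero)
    moreover have "cmod z * norm (P s *v x) \<le> \<bar>r\<bar> * (\<bar>p\<bar> * norm x * B)"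
      using z by (intro mult_mono calculation) auto
    ultimately show "norm ((cscale z (P s) + Q s) *v x) \<le> (\<bar>r\<bar> * (\<bar>p\<bar> * B) + \<bar>q\<bar> * B) * norm x"
      using norm_triangle_ineq[of "z *s (P s *v x)" "Q s *v x"]
      by (simp add: matrix_vector_mult_add_rdistrib cscale_mult_vector norm_smult_complex algebra_simps)
  qed
qed

section \<open>Convergence, differentiability and holomorphy of the Dyson series\<close>

lemma summable_dyson_bound: "summable (\<lambda>k. (a::real) ^ k / fact k * b)"
  using summable_mult2[OF summable_exp[of a], of b] by (simp add: field_simps)

text \<open>A single majorant for all t and all z in a disc. It serves twice in the Weierstrass
  test: in t, to differentiate the series, and in z, to pass holomorphy to the limit.\<close>

lemma norm_dyson_term_bound:
  obtains M where "summable M" 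
    "\<And>z k t. cmod z \<le> r \<Longrightarrow> t \<in> {0..T} \<Longrightarrow> norm (dyson_term P Q u0 z k t) \<le> M k"
proof -
  obtain L where L: "L \<ge> 0"
    "\<And>z s x. cmod z \<le> r \<Longrightarrow> s \<in> {0..T} \<Longrightarrow> norm ((cscale z (P s) + Q s) *v x) \<le> L * norm x"
    using dyson_operator_bound[of r] by metis
  show ?thesis
  proof (rule that[OF summable_dyson_bound[of "L * T" "norm u0"]])
    fix z :: complex and k t assume *: "cmod z \<le> r" "t \<in> {0..T}"
    have "norm (dyson_term P Q u0 z k t) \<le> (L * t) ^ k / fact k * norm u0"
      using * L by (intro norm_dyson_term_le) auto
    also have "\<dots> \<le> (L * T) ^ k / fact k * norm u0"
      using * L by (intro mult_right_mono divide_right_mono power_mono mult_left_mono) auto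
    finally show "norm (dyson_term P Q u0 z k t) \<le> (L * T) ^ k / fact k * norm u0" .
  qed
qed

lemma summable_dyson_term: "t \<in> {0..T} \<Longrightarrow> summable (\<lambda>k. dyson_term P Q u0 z k t)"
  using norm_dyson_term_bound[of "cmod z"] by (metis order_refl summable_comparison_test')

lemma has_vector_derivative_dyson_series:
  assumes t: "t \<in> {0..T}"
  shows "((\<lambda>t. \<Sum>k. dyson_term P Q u0 z k t) has_vector_derivative
    (cscale z (P t) + Q t) *v (\<Sum>k. dyson_term P Q u0 z k t)) (at t within {0..T})"
proof -
  let ?f = "\<lambda>k. dyson_term P Q u0 z k"
  let ?B = "\<lambda>s. cscale z (P s) + Q s"
  \<comment> \<open>\<open>D k\<close> is the derivative of the k-th term. The term of index 0 is
    constant, and every later one differentiates to the operator applied to its predecessor, so the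
    derived series is the shifted original.\<close>
  define D where "D k s = (case k of 0 \<Rightarrow> 0 | Suc k \<Rightarrow> ?B s *v ?f k s)" for k s
  obtain L where L: "L \<ge> 0" "\<And>s x. s \<in> {0..T} \<Longrightarrow> norm (?B s *v x) \<le> L * norm x"
    using dyson_operator_bound[of "cmod z"] by (metis order_refl)
  obtain M where M: "summable M" "\<And>k s. s \<in> {0..T} \<Longrightarrow> norm (?f k s) \<le> M k"
    using norm_dyson_term_bound[of "cmod z"] by (metis order_refl)
  have lim0: "uniform_limit {0..T} (\<lambda>n s. \<Sum>i<n. D i s) (\<lambda>s. suminf (\<lambda>i. D i s)) sequentially"
  proof (rule Weierstrass_m_test)
    show "summable (\<lambda>k. case k of 0 \<Rightarrow> 0 | Suc k \<Rightarrow> L * M k)"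
      by (subst summable_Suc_iff[symmetric]) (simp add: M summable_mult)
    show "norm (D k s) \<le> (case k of 0 \<Rightarrow> 0 | Suc k \<Rightarrow> L * M k)" if "s \<in> {0..T}" for k s
    proof (cases k)
      case (Suc j)
      have "norm (?B s *v ?f j s) \<le> L * norm (?f j s)" by (rule L) fact
      also have "\<dots> \<le> L * M j" using that L M by (intro mult_left_mono) auto
      finally show ?thesis using Suc by (simp add: D_def)
    qed (simp add: D_def)
  qed
  have D_suminf: "suminf (\<lambda>i. D i s) = ?B s *v (\<Sum>k. ?f k s)" if "s \<in> {0..T}" for s
  proof -
    interpret bounded_bilinear "(*v) :: complex^'n^'n \<Rightarrow> complex^'n \<Rightarrow> complex^'n"
      by (rule bounded_bilinear_matrix_vector_mult)
    have "(\<lambda>k. D (Suc k) s) sums (?B s *v (\<Sum>k. ?f k s))"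
      unfolding D_def nat.case
      by (intro bounded_linear.sums[OF bounded_linear_right] summable_sums summable_dyson_term that)
    hence "(\<lambda>k. D k s) sums (?B s *v (\<Sum>k. ?f k s) + D 0 s)" by (rule sums_Suc)
    thus ?thesis by (simp add: D_def sums_iff)
  qed
  have lim: "uniform_limit {0..T} (\<lambda>n s. \<Sum>i<n. D i s) (\<lambda>s. ?B s *v (\<Sum>k. ?f k s)) sequentially"
    by (rule iffD1[OF uniform_limit_cong'[OF refl D_suminf] lim0])
  have "\<exists>g. \<forall>s\<in>{0..T}. (\<lambda>n. ?f n s) sums g s \<and>
      (g has_derivative (\<lambda>h. h *\<^sub>R (?B s *v (\<Sum>k. ?f k s)))) (at s within {0..T})"
  proof (rule has_derivative_series[where f' = "\<lambda>n s h. h *\<^sub>R D n s"])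
    show "convex {0..T}" by simp
    show "(?f n has_derivative (\<lambda>h. h *\<^sub>R D n s)) (at s within {0..T})" if "s \<in> {0..T}" for n s
    proof (cases n)
      case 0
      have "?f 0 = (\<lambda>_. u0)" by (simp add: fun_eq_iff dyson_term_def)
      thus ?thesis using 0 by (simp add: D_def)
    next
      case (Suc k)
      thus ?thesis
        using has_vector_derivative_dyson_term[OF that, of z k]
        by (simp add: D_def has_vector_derivative_def)
    qed
    show "\<forall>\<^sub>F n in sequentially. \<forall>s\<in>{0..T}. \<forall>h.
        norm ((\<Sum>i<n. h *\<^sub>R D i s) - h *\<^sub>R (?B s *v (\<Sum>k. ?f k s))) \<le> e * norm h" if "e > 0" for e
      using uniform_limitD[OF lim that]
    proof eventually_elim
      case (elim n)
      show ?case
      proof (intro ballI allI)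
        fix s h assume s: "s \<in> {0..T}"
        have "norm ((\<Sum>i<n. h *\<^sub>R D i s) - h *\<^sub>R (?B s *v (\<Sum>k. ?f k s)))
            = \<bar>h\<bar> * dist (\<Sum>i<n. D i s) (?B s *v (\<Sum>k. ?f k s))"
          by (simp add: dist_norm scaleR_sum_right[symmetric] scaleR_diff_right[symmetric])
        also have "\<dots> \<le> \<bar>h\<bar> * e"
          using elim s by (intro mult_left_mono) (auto intro: less_imp_le)
        finally show "norm ((\<Sum>i<n. h *\<^sub>R D i s) - h *\<^sub>R (?B s *v (\<Sum>k. ?f k s))) \<le> e * norm h"
          by (simp add: mult.commute)
      qed
    qed
    show "t \<in> {0..T}" by fact
    show "(\<lambda>n. ?f n t) sums (\<Sum>k. ?f k t)"
      by (intro summable_sums summable_dyson_term t)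
  qed
  then obtain g where g: "\<And>s. s \<in> {0..T} \<Longrightarrow> (\<Sum>k. ?f k s) = g s"
    and dg: "(g has_vector_derivative ?B t *v (\<Sum>k. ?f k t)) (at t within {0..T})"
    using t unfolding has_vector_derivative_def by (metis sums_unique)
  show ?thesis
    by (rule has_vector_derivative_transform[OF t _ dg]) (simp add: g)
qed

text \<open>The partial sums are polynomials in z and converge uniformly on the unit disc around
  every point.\<close>

lemma holomorphic_on_dyson_series:
  assumes t: "t \<in> {0..T}"
  shows "(\<lambda>z. (\<Sum>k. dyson_term P Q u0 z k t) $ i) holomorphic_on UNIV"
proof (rule holomorphic_uniform_sequence[where f = "\<lambda>n z. \<Sum>k<n. dyson_term P Q u0 z k t $ i"])
  show "(\<lambda>z. \<Sum>k<n. dyson_term P Q u0 z k t $ i) holomorphic_on UNIV" for n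
    unfolding dyson_term_def by (simp, intro holomorphic_intros)
  fix z :: complex
  obtain M where M: "summable M"
    "\<And>w k t. cmod w \<le> cmod z + 1 \<Longrightarrow> t \<in> {0..T} \<Longrightarrow> norm (dyson_term P Q u0 w k t) \<le> M k"
    using norm_dyson_term_bound[of "cmod z + 1"] by metis
  have *: "cmod w \<le> cmod z + 1" if "w \<in> cball z 1" for w
    using that norm_triangle_ineq2[of w z] by (simp add: dist_norm norm_minus_commute)
  have "uniform_limit (cball z 1) (\<lambda>n w. \<Sum>k<n. dyson_term P Q u0 w k t $ i)
      (\<lambda>w. \<Sum>k. dyson_term P Q u0 w k t $ i) sequentially"
    by (rule Weierstrass_m_test[OF _ M(1)])
       (meson * M(2) Finite_Cartesian_Product.norm_nth_le order_trans t)
  moreover have "(\<Sum>k. dyson_term P Q u0 w k t $ i) = (\<Sum>k. dyson_term P Q u0 w k t) $ i" for w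
    by (rule bounded_linear.suminf[OF bounded_linear_vec_nth summable_dyson_term[OF t], symmetric])
  ultimately show "\<exists>d>0. cball z d \<subseteq> UNIV \<and>
      uniform_limit (cball z d) (\<lambda>n z. \<Sum>k<n. dyson_term P Q u0 z k t $ i)
        (\<lambda>z. (\<Sum>k. dyson_term P Q u0 z k t) $ i) sequentially"
    by (intro exI[of _ 1]) simp
qed simp

lemma linear_ode_holomorphic_parameter:
  obtains v :: "complex \<Rightarrow> real \<Rightarrow> complex^'n" where "\<And>z. v z 0 = u0"
    and "\<And>z t. t \<in> {0..T} \<Longrightarrow>
      (v z has_vector_derivative (cscale z (P t) + Q t) *v v z t) (at t within {0..T})"
    and "\<And>t i. t \<in> {0..T} \<Longrightarrow> (\<lambda>z. v z t $ i) holomorphic_on UNIV"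
proof (rule that)
  show "(\<Sum>k. dyson_term P Q u0 z k 0) = u0" for z
    using sums_single[of 0 "\<lambda>_. u0"] by (simp add: dyson_term_0 sums_iff)
qed (rule has_vector_derivative_dyson_series holomorphic_on_dyson_series; assumption)+

end

section \<open>The Cauchy density on the lower half plane\<close>

lemma
  shows integrable_cauchy_density: "integrable lborel (\<lambda>x::real. 1 / (pi * (1 + x\<^sup>2)))"
    and LBINT_cauchy_density: "(LBINT x. 1 / (pi * (1 + x\<^sup>2))) = 1"
proof -
  have eq: "1 / (pi * (1 + x\<^sup>2)) = inverse (1 + x\<^sup>2) / pi" for x :: real
    by (simp add: field_simps)
  show "integrable lborel (\<lambda>x::real. 1 / (pi * (1 + x\<^sup>2)))"
    unfolding eq using integrable_inverse_1_plus_square by (simp add: set_integrable_def)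
  show "(LBINT x. 1 / (pi * (1 + x\<^sup>2))) = 1"
    unfolding eq using LBINT_inverse_1_plus_square
    by (simp add: interval_lebesgue_integral_def set_lebesgue_integral_def)
qed

text \<open>Links the Lebesgue integral over the line to the integrals over [-R, R] that arise from
  contours, by dominated convergence.\<close>

lemma integral_symmetric_at_top:
  fixes f :: "real \<Rightarrow> 'a::euclidean_space"
  assumes f: "integrable lborel f"
  shows "((\<lambda>R. integral {-R..R} f) \<longlongrightarrow> (LBINT x. f x)) at_top"
proof -
  have "((\<lambda>R. LBINT x. indicator {-R..R} x *\<^sub>R f x) \<longlongrightarrow> (LBINT x. f x)) at_top"
  proof (rule integral_dominated_convergence_at_top[where w = "\<lambda>x. norm (f x)"])
    show "AE x in lborel. ((\<lambda>R. indicator {-R..R} x *\<^sub>R f x) \<longlongrightarrow> f x) at_top"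
    proof (intro AE_I2 tendsto_eventually)
      fix x show "\<forall>\<^sub>F R in at_top. indicator {-R..R} x *\<^sub>R f x = f x"
        using eventually_ge_at_top[of "\<bar>x\<bar>"] by eventually_elim (auto simp: indicator_def)
    qed
    show "integrable lborel (\<lambda>x. norm (f x))" using f by (rule integrable_norm)
  qed (use f in \<open>auto simp: indicator_def intro!: always_eventually\<close>)
  moreover have "(LBINT x. indicator {-R..R} x *\<^sub>R f x) = integral {-R..R} f" for R
    using set_borel_integral_eq_integral(2)[of "{-R..R}" f] f
      set_integrable_subset[of lborel UNIV f "{-R..R}"]
    by (simp add: set_lebesgue_integral_def set_integrable_def)
  ultimately show ?thesis by simp
qed

text \<open>The Cauchy density is the Poisson kernel of the half plane at \<open>-\<i>\<close>. Subtracting \<open>F (-\<i>)\<close>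
  removes the pole, so that Cauchy's theorem for convex sets applies to large half discs.\<close>

lemma lower_half_plane_cauchy_density:
  assumes hol: "F holomorphic_on UNIV" and bound: "\<And>z. Im z \<le> 0 \<Longrightarrow> cmod (F z) \<le> C"
  shows "integrable lborel (\<lambda>x. F (complex_of_real x) / complex_of_real (pi * (1 + x\<^sup>2)))"
    and "(LBINT x. F (complex_of_real x) / complex_of_real (pi * (1 + x\<^sup>2))) = F (-\<i>)"
proof -
  have contF: "continuous_on UNIV (\<lambda>x::real. F (complex_of_real x))"
    by (rule continuous_on_compose2[OF holomorphic_on_imp_continuous_on[OF hol]
        continuous_on_of_real[OF continuous_on_id] subset_UNIV])
  hence [measurable]: "(\<lambda>x::real. F (complex_of_real x)) \<in> borel_measurable borel"
    by (rule borel_measurable_continuous_onI)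
  have int: "integrable lborel (\<lambda>x::real. complex_of_real (1 / (pi * (1 + x\<^sup>2))))"
    using integrable_cauchy_density by (rule integrable_of_real)
  show intF: "integrable lborel (\<lambda>x. F (complex_of_real x) / complex_of_real (pi * (1 + x\<^sup>2)))"
  proof (rule Bochner_Integration.integrable_bound[OF integrable_mult_right[OF integrable_cauchy_density, of C]])
    show "AE x::real in lborel. norm (F (complex_of_real x) / complex_of_real (pi * (1 + x\<^sup>2))) \<le> norm (C * (1 / (pi * (1 + x\<^sup>2))))"
    proof (rule AE_I2)
      fix x :: real
      have "cmod (F x) \<le> \<bar>C\<bar>" using bound[of x] by simp
      moreover have "cmod (1 + (complex_of_real x)\<^sup>2) = 1 + x\<^sup>2"
        by (metis norm_of_real of_real_1 of_real_add of_real_power abs_of_nonneg add_nonneg_nonneg zero_le_one zero_le_power2)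
      ultimately show "norm (F (complex_of_real x) / complex_of_real (pi * (1 + x\<^sup>2))) \<le> norm (C * (1 / (pi * (1 + x\<^sup>2))))"
        by (simp add: norm_divide norm_mult abs_mult divide_right_mono)
    qed
  qed measurable
  define a where "a = F (-\<i>)"
  define g where "g = (\<lambda>z. if z = -\<i> then deriv F (-\<i>) else (F z - a) / (z - (-\<i>)))"
  define h where "h z = g z / (z - \<i>)" for z
  have "g holomorphic_on UNIV"
    unfolding g_def a_def using pole_lemma[OF hol, of "-\<i>"] by simp
  hence holh: "h holomorphic_on {z. Im z < 1}"
    unfolding h_def by (intro holomorphic_intros) (auto intro: holomorphic_on_subset)
  have h_eq: "h z = (F z - a) / (1 + z\<^sup>2)" if "z \<noteq> -\<i>" for z
  proof -
    have "1 + z\<^sup>2 = (z - (-\<i>)) * (z - \<i>)" by (simp add: algebra_simps power2_eq_square)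
    thus ?thesis using that unfolding h_def g_def by (simp only: if_False divide_divide_eq_left)
  qed
  have C: "C \<ge> 0" by (rule order_trans[OF norm_ge_zero bound[of 0]]) simp
  have a: "cmod a \<le> C" unfolding a_def by (rule bound) simp
  have h_bound: "cmod (h z) \<le> 2 * C / (R\<^sup>2 - 1)" if "cmod z = R" "R > 1" "Im z \<le> 0" for z R
  proof -
    have "cmod (F z - a) \<le> 2 * C"
      using norm_triangle_ineq4[of "F z" a] bound[OF that(3)] a by linarith
    moreover have "R\<^sup>2 - 1 \<le> cmod (1 + z\<^sup>2)"
      using norm_diff_ineq[of "z\<^sup>2" 1] that by (simp add: norm_power add.commute)
    moreover have "R\<^sup>2 - 1 > 0" using that by simp
    moreover have "z \<noteq> -\<i>" using that by auto
    ultimately show ?thesis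
      unfolding h_eq[OF \<open>z \<noteq> -\<i>\<close>] norm_divide using C by (intro frac_le) auto
  qed
  have arc_integral: "cmod (integral {-R..R} (\<lambda>x. h (complex_of_real x))) \<le> 2 * C / (R\<^sup>2 - 1) * R * pi"
    if R: "R > 1" for R
  proof -
    \<comment> \<open>The segment runs from -R to R and the arc returns clockwise through the lower
      half plane, where the bound on F is available.\<close>
    let ?A = "part_circlepath 0 R 0 (-pi)" and ?L = "linepath (- complex_of_real R) (complex_of_real R)"
    have ends: "pathstart ?A = complex_of_real R" "pathfinish ?A = - complex_of_real R"
      by (simp_all add: exp_minus)
    have imA: "Im z \<le> 0 \<and> cmod z = R" if z: "z \<in> path_image ?A" for z
    proof -
      obtain t where t: "t \<in> closed_segment 0 (-pi)" "z = complex_of_real R * cis t"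
        using z R unfolding path_image_part_circlepath' by auto
      hence "-pi \<le> t" "t \<le> 0" by (simp_all add: closed_segment_eq_real_ivl not_le[THEN iffD2, OF pi_gt_zero])
      hence "sin t \<le> 0" using sin_ge_zero[of "-t"] by simp
      thus ?thesis
        using t R by (auto simp: norm_mult mult_nonneg_nonpos)
    qed
    have imL: "Im z < 1" if z: "z \<in> path_image ?L" for z
      using z by (auto simp: closed_segment_def)
    have "(h has_contour_integral 0) (?L +++ ?A)"
    proof (rule Cauchy_theorem_convex_simple[OF holh])
      show "convex {z. Im z < 1}" by (rule convex_halfspace_Im_lt)
      show "path_image (?L +++ ?A) \<subseteq> {z. Im z < 1}"
        using imA imL ends by (subst path_image_join) (force simp: path_image_linepath)+
    qed (use ends in auto)
    moreover have cont: "continuous_on (path_image ?A) h" "continuous_on (path_image ?L) h"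
      using imA imL by (force intro!: continuous_on_subset[OF holomorphic_on_imp_continuous_on[OF holh]])+
    have intA: "h contour_integrable_on ?A" 
      by (rule contour_integrable_continuous_part_circlepath[OF cont(1)])
    have intL: "h contour_integrable_on ?L"
      using cont(2) by (intro contour_integrable_continuous_linepath) simp
    ultimately have "contour_integral ?L h = - contour_integral ?A h"
      using contour_integral_join[of h ?L ?A] intA intL ends
      by (simp add: contour_integral_unique eq_neg_iff_add_eq_0)
    moreover have "contour_integral ?L h = integral {-R..R} (\<lambda>x. h (complex_of_real x))"
      using R by (subst contour_integral_linepath_Reals_eq) auto
    moreover have "cmod (contour_integral ?A h) \<le> 2 * C / (R\<^sup>2 - 1) * R * \<bar>-pi - 0\<bar>"
      using R C imA by (intro contour_integral_bound_part_circlepath intA h_bound) auto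
    ultimately show ?thesis by simp
  qed
  \<comment> \<open>On the real line h / pi is the wanted integrand minus a times a density of total
    mass 1. Once its integral is known to be 0, the claim follows.\<close>
  have real_eq: "h (complex_of_real x) / complex_of_real pi = F (complex_of_real x) / complex_of_real (pi * (1 + x\<^sup>2)) - a * complex_of_real (1 / (pi * (1 + x\<^sup>2)))" for x :: real
  proof -
    have "complex_of_real x \<noteq> -\<i>" by (simp add: complex_eq_iff)
    thus ?thesis by (simp add: h_eq diff_divide_distrib mult.commute)
  qed
  have inth: "integrable lborel (\<lambda>x::real. h (complex_of_real x) / complex_of_real pi)"
    unfolding real_eq using intF int by (intro Bochner_Integration.integrable_diff integrable_mult_right)
  have "(LBINT x::real. h (complex_of_real x) / complex_of_real pi) = (LBINT x. F (complex_of_real x) / complex_of_real (pi * (1 + x\<^sup>2))) - a"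
    unfolding real_eq
    using Bochner_Integration.integral_diff[OF intF integrable_mult_right[OF int, of a]]
      LBINT_cauchy_density
    by (simp only: integral_mult_right_zero integral_complex_of_real) simp
  moreover have "(LBINT x::real. h (complex_of_real x) / complex_of_real pi) = 0"
  proof (rule tendsto_unique[OF _ integral_symmetric_at_top[OF inth]])
    show "((\<lambda>R. integral {-R..R} (\<lambda>x. h (complex_of_real x) / complex_of_real pi)) \<longlongrightarrow> 0) at_top"
    proof (rule Lim_null_comparison)
      show "\<forall>\<^sub>F R in at_top. cmod (integral {-R..R} (\<lambda>x. h (complex_of_real x) / complex_of_real pi)) \<le> 2 * C * (R / (R\<^sup>2 - 1))"
        using eventually_gt_at_top[of 1]
      proof eventually_elim
        case (elim R)
        thus ?case using arc_integral[OF elim] by (simp add: norm_divide field_simps)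
      qed
      show "((\<lambda>R::real. 2 * C * (R / (R\<^sup>2 - 1))) \<longlongrightarrow> 0) at_top"
        by real_asymp
    qed
  qed simp
  ultimately show "(LBINT x. F (complex_of_real x) / complex_of_real (pi * (1 + x\<^sup>2))) = F (-\<i>)"
    by (simp add: a_def)
qed

lemma
  shows set_integrable_exp_minus: "set_integrable lborel {p..} (\<lambda>q::real. exp (- q))"
    and LBINT_exp_minus: "(LBINT q:{p..}. exp (- q)) = exp (- p)"
proof -
  have lim: "((\<lambda>q::real. - exp (- q)) \<longlongrightarrow> 0) at_top" by real_asymp
  have "(\<integral>\<^sup>+q. ennreal (exp (- q)) * indicator {p..} q \<partial>lborel) = 0 - - exp (- p)"
    by (rule nn_integral_FTC_atLeast[OF _ _ _ lim]) (auto intro!: derivative_eq_intros)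
  hence *: "(\<integral>\<^sup>+q. ennreal (indicator {p..} q * exp (- q)) \<partial>lborel) = ennreal (exp (- p))"
    by (simp add: ennreal_mult' ennreal_indicator mult.commute)
  have "has_bochner_integral lborel (\<lambda>q. indicator {p..} q * exp (- q)) (exp (- p))"
    by (rule has_bochner_integral_nn_integral[OF _ _ _ *]) auto
  thus "set_integrable lborel {p..} (\<lambda>q::real. exp (- q))" "(LBINT q:{p..}. exp (- q)) = exp (- p)"
    unfolding set_integrable_def set_lebesgue_integral_def
    by (simp_all add: has_bochner_integral_iff)
qed

section \<open>Recovery of the solution\<close>

text \<open>Reduces the vector integral to its components, to which the scalar contour argument
  applies.\<close>

lemma has_bochner_integral_vec_complex:
  fixes f :: "'a \<Rightarrow> complex^'n"
  assumes "\<And>i. has_bochner_integral M (\<lambda>x. f x $ i) (I $ i)"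
  shows "has_bochner_integral M f I"
proof -
  have "has_bochner_integral M (\<lambda>x. \<Sum>i\<in>UNIV. f x $ i *s axis i 1) (\<Sum>i\<in>UNIV. I $ i *s axis i 1)"
    by (intro has_bochner_integral_sum has_bochner_integral_bounded_linear[OF bounded_linear_smult_left]
        assms)
  thus ?thesis by (simp only: basis_expansion)
qed

lemma schrodingerized_eq:
  fixes A :: "real \<Rightarrow> complex^'n^'n" and u :: "real \<Rightarrow> complex^'n"
  assumes A: "continuous_on {0..T} A"
    and U: "is_propagator T A U"
    and u: "\<And>t. t \<in> {0..T} \<Longrightarrow> (u has_vector_derivative A t *v u t) (at t within {0..T})"
    and u0: "u 0 = u0"
    and p: "lambda_max_plus T (\<lambda>t. herm_part1 (A t)) * T \<le> p"
    and t: "t \<in> {0..T}"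
  shows "schrodingerized U u0 t p = exp (- p) *\<^sub>R u t"
proof -
  define H1 where "H1 t = herm_part1 (A t)" for t
  \<comment> \<open>The generator with complex frequency z: real z gives the equation of the
    propagator, and z = -\<i> gives \<open>A\<close> itself by
    \<open>herm_part_decomp\<close>.\<close>
  define G where "G z t = cscale z (cscale \<i> (H1 t)) + cscale \<i> (herm_part2 (A t))" for z t
  define lam where "lam = lambda_max_plus T H1"
  have c: "continuous_on {0..T} (\<lambda>t. cscale \<i> (H1 t))" "continuous_on {0..T} (\<lambda>t. cscale \<i> (herm_part2 (A t)))"
    unfolding H1_def by (intro continuous_on_cscale continuous_on_herm_part A)+
  obtain v where v0: "\<And>z. v z 0 = u0"
    and v: "\<And>z t. t \<in> {0..T} \<Longrightarrow> (v z has_vector_derivative G z t *v v z t) (at t within {0..T})"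
    and hol: "\<And>t i. t \<in> {0..T} \<Longrightarrow> (\<lambda>z. v z t $ i) holomorphic_on UNIV"
    by (rule linear_ode_holomorphic_parameter[OF c, of u0, folded G_def]) (rule that)
  have "x \<bullet> (G z t *v x) = - Im z * (x \<bullet> (H1 t *v x))" for x z t
    unfolding G_def H1_def cscale_cscale matrix_vector_mult_add_rdistrib inner_add_right
    by (simp add: hermitian_inner_cscale conj_transpose_herm_part)
  moreover have "x \<bullet> (H1 t *v x) \<le> lam * (x \<bullet> x)" if "0 < t" "t < T" for x t
    unfolding lam_def
    by (rule rayleigh_le_lambda_max_plus[OF _ _ that])
       (auto simp: H1_def conj_transpose_herm_part intro!: continuous_on_herm_part A)
  \<comment> \<open>The Rayleigh bound is multiplied by - Im z, which is why only the lower half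
    plane is admissible.\<close>
  ultimately have G: "x \<bullet> (G z t *v x) \<le> (- Im z * lam) * (x \<bullet> x)"
    if "Im z \<le> 0" "0 < t" "t < T" for x z t
    using that by (metis mult.assoc mult_left_mono neg_0_le_iff_le)
  have v_bound: "norm (v z t) \<le> exp (- Im z * lam * t) * norm u0" if "Im z \<le> 0" for z
    using linear_ode_norm_bound[OF v G[OF that] t] by (simp add: v0)
  have vU: "v (complex_of_real \<xi>) t = U t \<xi> *v u0" for \<xi>
  proof (rule linear_ode_unique[OF v _ G _ t])
    fix s assume s: "s \<in> {0..T}"
    have G_eq: "cscale \<i> (\<xi> *\<^sub>R herm_part1 (A s) + herm_part2 (A s)) = G \<xi> s"
      by (simp add: G_def H1_def cscale_add cscale_of_real[symmetric] cscale_cscale mult.commute)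
    have "((\<lambda>s. U s \<xi>) has_vector_derivative G \<xi> s ** U s \<xi>) (at s within {0..T})"
      unfolding G_eq[symmetric] using U s unfolding is_propagator_def by blast
    hence "((\<lambda>s. U s \<xi> *v u0) has_vector_derivative (G \<xi> s ** U s \<xi>) *v u0) (at s within {0..T})"
      by (rule bounded_linear.has_vector_derivative[OF
            bounded_bilinear.bounded_linear_left[OF bounded_bilinear_matrix_vector_mult]])
    thus "((\<lambda>s. U s \<xi> *v u0) has_vector_derivative G \<xi> s *v (U s \<xi> *v u0)) (at s within {0..T})"
      by (simp add: matrix_vector_mul_assoc)
  next
    show "v (complex_of_real \<xi>) 0 = U 0 \<xi> *v u0"
      using U by (simp add: is_propagator_def v0)
  qed auto
  have vu: "v (-\<i>) t = u t"
  proof (rule linear_ode_unique[OF v _ G _ t])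
    have "G (-\<i>) s = A s" for s
      using herm_part_decomp[of "A s"] by (simp add: G_def H1_def cscale_cscale cscale_1)
    thus "(u has_vector_derivative G (-\<i>) s *v u s) (at s within {0..T})" if "s \<in> {0..T}" for s
      using u[OF that] by simp
  qed (auto simp: v0 u0)
  \<comment> \<open>One threshold works for all times because lam is nonnegative.\<close>
  have lam_p: "lam * t \<le> p"
  proof -
    have "lam * t \<le> lam * T"
      using t lambda_max_plus_nonneg by (intro mult_left_mono) (auto simp: lam_def)
    thus ?thesis using p by (simp add: lam_def H1_def[abs_def])
  qed
  define F where "F i z = exp (- \<i> * z * p) * v z t $ i" for i z
  have holF: "F i holomorphic_on UNIV" for i
    unfolding F_def by (intro holomorphic_intros hol t)
  have boundF: "cmod (F i z) \<le> norm u0" if "Im z \<le> 0" for i z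
  proof -
    have "cmod (F i z) \<le> exp (Im z * p) * norm (v z t)"
      unfolding F_def norm_mult by (intro mult_mono Finite_Cartesian_Product.norm_nth_le) auto
    also have "\<dots> \<le> exp (Im z * p) * (exp (- Im z * lam * t) * norm u0)"
      by (intro mult_left_mono v_bound that) auto
    \<comment> \<open>Growth and decay merge into one exponent, the product of Im z \<le> 0 and p -
      lam * t \<ge> 0.\<close>
    also have "\<dots> = exp (Im z * (p - lam * t)) * norm u0"
      by (simp add: exp_add[symmetric] algebra_simps)
    also have "\<dots> \<le> 1 * norm u0"
      using that lam_p by (intro mult_right_mono) (auto intro: mult_nonpos_nonneg)
    finally show ?thesis by simp
  qed
  have "has_bochner_integral lborel
    (\<lambda>\<xi>. exp (- \<i> * \<xi> * p) *s ((1 / (pi * (1 + \<xi>\<^sup>2))) *\<^sub>R (U t \<xi> *v u0))) (exp (- p) *\<^sub>R u t)"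
  proof (rule has_bochner_integral_vec_complex)
    fix i
    have "has_bochner_integral lborel (\<lambda>\<xi>. F i (complex_of_real \<xi>) / complex_of_real (pi * (1 + \<xi>\<^sup>2))) (F i (-\<i>))"
      using lower_half_plane_cauchy_density[OF holF boundF] by (simp add: has_bochner_integral_iff)
    moreover have "F i (-\<i>) = (exp (- p) *\<^sub>R u t) $ i"
      by (simp add: F_def vu exp_of_real[symmetric] scaleR_conv_of_real[where 'a = complex])
    moreover have "F i (complex_of_real \<xi>) / complex_of_real (pi * (1 + \<xi>\<^sup>2)) =
        (exp (- \<i> * \<xi> * p) *s ((1 / (pi * (1 + \<xi>\<^sup>2))) *\<^sub>R (U t \<xi> *v u0))) $ i" for \<xi>
      by (simp add: F_def vU scaleR_conv_of_real[where 'a = complex])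
    ultimately show "has_bochner_integral lborel
        (\<lambda>\<xi>. (exp (- \<i> * \<xi> * p) *s ((1 / (pi * (1 + \<xi>\<^sup>2))) *\<^sub>R (U t \<xi> *v u0))) $ i)
        ((exp (- p) *\<^sub>R u t) $ i)"
      by simp
  qed
  thus ?thesis
    unfolding schrodingerized_def by (rule has_bochner_integral_integral_eq)
qed

text \<open>Integrability of the tail is part of the conclusion, since the Bochner integral of a
  non-integrable function is 0 by convention and the integral formula alone would not express
  convergence.\<close>

theorem theorem3p1:
  fixes T :: real
    and A :: "real \<Rightarrow> complex^'n^'n"
    and u0 :: "complex^'n"
    and U :: "real \<Rightarrow> real \<Rightarrow> complex^'n^'n"
    and w :: "real \<Rightarrow> real \<Rightarrow> complex^'n"
    and u :: "real \<Rightarrow> complex^'n"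
    and p_diamond :: real
  assumes T_pos: "T > 0"
    and A_cont: "continuous_on {0..T} A"
    and U: "is_propagator T A U"
    and w: "\<And>t p. t \<in> {0..T} \<Longrightarrow> w t p = schrodingerized U u0 t p"
    and u_ode: "\<And>t. t \<in> {0..T} \<Longrightarrow> (u has_vector_derivative A t *v u t) (at t within {0..T})"
    and u_init: "u 0 = u0"
    and p_diamond: "p_diamond \<ge> lambda_max_plus T (\<lambda>t. herm_part1 (A t)) * T"
  shows "\<forall>t\<in>{0..T}. \<forall>p\<ge>p_diamond.
           u t = exp p *\<^sub>R w t p \<and>
           set_integrable lborel {p..} (w t) \<and>
           u t = exp p *\<^sub>R (LBINT q:{p..}. w t q)"
proof (intro ballI allI impI)
  fix t p assume t: "t \<in> {0..T}" and p: "p_diamond \<le> p"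
  \<comment> \<open>The pointwise formula holds on the whole ray above p, so the tail integral of
    \<open>w t\<close> is that of exp (- q) times the fixed vector \<open>u t\<close>.\<close>
  have w_eq: "w t q = exp (- q) *\<^sub>R u t" if "q \<ge> p" for q
    using schrodingerized_eq[OF A_cont U u_ode u_init _ t, of q] w[OF t, of q] p_diamond p that by simp
  hence indicator: "(\<lambda>q. indicator {p..} q *\<^sub>R w t q) = (\<lambda>q. (indicator {p..} q *\<^sub>R exp (- q)) *\<^sub>R u t)"
    by (auto simp: fun_eq_iff indicator_def)
  have "set_integrable lborel {p..} (w t)"
    unfolding set_integrable_def indicator
    using set_integrable_exp_minus[of p] by (intro integrable_scaleR_left) (simp add: set_integrable_def)
  moreover have "(LBINT q:{p..}. w t q) = exp (- p) *\<^sub>R u t"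
    unfolding set_lebesgue_integral_def indicator
    using set_integrable_exp_minus[of p] LBINT_exp_minus[of p]
    by (subst integral_scaleR_left) (simp_all add: set_integrable_def set_lebesgue_integral_def)
  ultimately show "u t = exp p *\<^sub>R w t p \<and> set_integrable lborel {p..} (w t) \<and>
      u t = exp p *\<^sub>R (LBINT q:{p..}. w t q)"
    by (simp add: w_eq exp_add[symmetric])
qed

end
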